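(* Let $d\ge 2$, let $Q_1,Q_2\subset\mathbb{RP}^d$ be distinct non-empty non-degenerate quadrics defined by non-degenerate quadratic forms $q_1,q_2$ on $\mathbb{R}^{d+1}$, and let $q_3$ be a quadratic form belonging to the pencil of $(q_1,q_2)$-confocal quadrics $\mathcal{F}(q_1^*,q_2^* )^*$ which is not colinear to $q_1$. Then the line-framed hypersurfaces over $Q_1$ induced by $q_3$ and by $q_2$ coincide: $\Sigma_{q_3}=\Sigma_{q_2}$.
   Context: For a non-degenerate quadratic form $q$ on $\mathbb{R}^{d+1}$ (also denoting its bilinear form), write $q(x,y)=\mathcal{Q}_0(Mx,y)$ with $\mathcal{Q}_0=\sum_{j=0}^d x_j^2$ and $M$ an invertible matrix; its dual form is $q^*(x,y)=\mathcal{Q}_0(M^{-1}x,y)$. For non-colinear quadratic forms $f,g$, the pencil is $\mathcal{F}(f,g)=\{\lambda f+\mu g:(\lambda,\mu)\in\mathbb{R}^2\setminus\{0\}\}$, and $\mathcal{F}(f,g)^*$ denotes the set of duals $h^*$ of the non-degenerate forms $h\in\mathcal{F}(f,g)$. The pencil of $(q_1,q_2)$-confocal quadrics is $\mathcal{F}(q_1^*,q_2^* )^*$; it contains $q_1$ and $q_2$. A quadric in $\mathbb{RP}^d$ is the zero set of a non-zero quadratic form, non-degenerate if the form is. The pole of a projective hyperplane $\mathbb{P}(W)$ with respect to a non-degenerate form $q$ is the point $\mathbb{P}(W^{\perp_q})$. For a non-degenerate form $q$ not colinear to $q_1$ and $p\in Q_1$, let $u$ be the pole of $T_pQ_1$ with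 respect to $q$; when $u\ne p$ let $L_q(p)$ be the line $pu$. Then $\Sigma_q=\{(p,L_q(p))\}$, where $p$ ranges over the points of $Q_1$ at which $L_q(p)$ is defined and transverse to $Q_1$. *)

theory Defs
  imports "HOL-Analysis.Analysis"
begin

text \<open>
  A projective subspace of \<open>\<real>P\<^sup>d\<close>, where \<open>d + 1 = CARD('n)\<close>, is represented by the linear
  subspace of \<open>real^'n\<close> it is the projectivization of: a point is a linear subspace of dimension 1.
  The Euclidean form \<open>Q\<^sub>0\<close> is the inner product.
\<close>

definition proj_point :: "(real^'n) set \<Rightarrow> bool" where
  "proj_point p \<longleftrightarrow> subspace p \<and> dim p = 1"

definition quadratic_form :: "(real^'n \<Rightarrow> real) \<Rightarrow> bool" where
  "quadratic_form q \<longleftrightarrow> (\<exists>B. bilinear B \<and> (\<forall>x. q x = B x x))"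

definition polar :: "(real^'n \<Rightarrow> real) \<Rightarrow> real^'n \<Rightarrow> real^'n \<Rightarrow> real" where
  "polar q x y = (q (x + y) - q x - q y) / 2"

definition form_matrix :: "(real^'n \<Rightarrow> real) \<Rightarrow> real^'n^'n" where
  "form_matrix q = (\<chi> i j. polar q (axis i 1) (axis j 1))"

lemma bilinear_polar:
  assumes "quadratic_form q"
  shows "bilinear (polar q)"
proof -
  obtain B where B: "bilinear B" "\<And>x. q x = B x x"
    using assms by (auto simp: quadratic_form_def)
  have eq: "polar q x y = (B x y + B y x) / 2" for x y
    by (simp add: polar_def B bilinear_ladd[OF B(1)] bilinear_radd[OF B(1)])
  show ?thesis
    unfolding bilinear_def
    by (auto intro!: linearI simp: eq bilinear_ladd[OF B(1)] bilinear_radd[OF B(1)]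
        bilinear_lmul[OF B(1)] bilinear_rmul[OF B(1)] add_divide_distrib distrib_left)
qed

lemma polar_form_matrix:
  assumes "quadratic_form q"
  shows "polar q x y = (form_matrix q *v x) \<bullet> y"
proof -
  have *: "bilinear (polar q)" by (rule bilinear_polar[OF assms])
  have comm: "polar q a b = polar q b a" for a b
    by (simp add: polar_def add.commute)
  have "polar q x y = polar q (\<Sum>j\<in>UNIV. x$j *\<^sub>R axis j 1) (\<Sum>i\<in>UNIV. y$i *\<^sub>R axis i 1)"
    using basis_expansion[of x] basis_expansion[of y] by (simp add: scalar_mult_eq_scaleR)
  also have "\<dots> = (\<Sum>(j,i)\<in>UNIV \<times> UNIV. polar q (x$j *\<^sub>R axis j 1) (y$i *\<^sub>R axis i 1))"
    by (rule bilinear_sum[OF *])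
  also have "\<dots> = (\<Sum>i\<in>UNIV. \<Sum>j\<in>UNIV. polar q (axis i 1) (axis j 1) * x$j * y$i)"
    unfolding sum.cartesian_product[symmetric]
    by (subst sum.swap) (simp add: bilinear_lmul[OF *] bilinear_rmul[OF *] comm mult_ac)
  also have "\<dots> = (form_matrix q *v x) \<bullet> y"
    by (simp add: inner_vec_def matrix_vector_mult_def form_matrix_def sum_distrib_right)
  finally show ?thesis .
qed

definition nondegenerate_form :: "(real^'n \<Rightarrow> real) \<Rightarrow> bool" where
  "nondegenerate_form q \<longleftrightarrow> quadratic_form q \<and> invertible (form_matrix q)"

definition dual_form :: "(real^'n \<Rightarrow> real) \<Rightarrow> real^'n \<Rightarrow> real" where
  "dual_form q x = (matrix_inv (form_matrix q) *v x) \<bullet> x"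

definition colinear_forms :: "(real^'n \<Rightarrow> real) \<Rightarrow> (real^'n \<Rightarrow> real) \<Rightarrow> bool" where
  "colinear_forms f g \<longleftrightarrow>
    (\<exists>a b. (a, b) \<noteq> (0, 0) \<and> (\<forall>x. a * f x + b * g x = 0))"

definition pencil :: "(real^'n \<Rightarrow> real) \<Rightarrow> (real^'n \<Rightarrow> real) \<Rightarrow> (real^'n \<Rightarrow> real) set" where
  "pencil f g = {(\<lambda>x. a * f x + b * g x) |a b. (a, b) \<noteq> (0, 0)}"

definition dual_set :: "(real^'n \<Rightarrow> real) set \<Rightarrow> (real^'n \<Rightarrow> real) set" where
  "dual_set F = {dual_form h |h. h \<in> F \<and> nondegenerate_form h}"

definition confocal_pencil :: "(real^'n \<Rightarrow> real) \<Rightarrow> (real^'n \<Rightarrow> real) \<Rightarrow> (real^'n \<Rightarrow> real) set"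
  where "confocal_pencil q\<^sub>1 q\<^sub>2 = dual_set (pencil (dual_form q\<^sub>1) (dual_form q\<^sub>2))"

definition quadric :: "(real^'n \<Rightarrow> real) \<Rightarrow> (real^'n) set set" where
  "quadric q = {p. proj_point p \<and> (\<forall>x\<in>p. q x = 0)}"

text \<open>
  The projective tangent space of \<open>Q\<close> at \<open>p\<close>, as a linear subspace: the velocities of curves in the
  cone \<open>\<Union>Q\<close> over \<open>Q\<close> that start at a non-zero vector of \<open>p\<close>.
\<close>

definition tangent_hyperplane :: "(real^'n) set set \<Rightarrow> (real^'n) set \<Rightarrow> (real^'n) set" where
  "tangent_hyperplane Q p =
    {v. \<exists>\<gamma>::real \<Rightarrow> real^'n. \<gamma> 0 \<in> p - {0} \<and> (\<forall>\<^sub>F t in nhds 0. \<gamma> t \<in> \<Union>Q) \<and>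
          (\<gamma> has_vector_derivative v) (at 0)}"

definition pole :: "(real^'n \<Rightarrow> real) \<Rightarrow> (real^'n) set \<Rightarrow> (real^'n) set" where
  "pole q W = {x. \<forall>w\<in>W. polar q x w = 0}"

definition proj_line :: "(real^'n) set \<Rightarrow> (real^'n) set \<Rightarrow> (real^'n) set" where
  "proj_line p u = span (p \<union> u)"

text \<open>
  Transversality at \<open>p\<close>, that is \<open>T\<^sub>pL + T\<^sub>pQ = T\<^sub>p\<real>P\<^sup>d\<close>, lifted to the vector space; the
  lift of \<open>T\<^sub>pL\<close> is \<open>L\<close> itself.
\<close>

definition transverse_at :: "(real^'n) set \<Rightarrow> (real^'n) set set \<Rightarrow> (real^'n) set \<Rightarrow> bool" where
  "transverse_at L Q p \<longleftrightarrow> span (L \<union> tangent_hyperplane Q p) = UNIV"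

definition line_framed_hypersurface ::
    "(real^'n) set set \<Rightarrow> (real^'n \<Rightarrow> real) \<Rightarrow> ((real^'n) set \<times> (real^'n) set) set" where
  "line_framed_hypersurface Q q =
    {(p, proj_line p u) |p u. p \<in> Q \<and> u = pole q (tangent_hyperplane Q p) \<and> u \<noteq> p \<and>
        transverse_at (proj_line p u) Q p}"

end

theory Submission
  imports Defs
begin

text \<open>
  Write \<open>M\<^sub>i\<close> for the matrix of \<open>q\<^sub>i\<close>. If \<open>p\<close> is spanned by \<open>x\<close>, then \<open>T\<^sub>pQ\<^sub>1\<close> is the
  hyperplane orthogonal to \<open>M\<^sub>1 x\<close> (lemma \<open>tangent_hyperplane_quadric\<close>), so its pole with
  respect to a non-degenerate form with matrix \<open>M\<close> is spanned by \<open>M\<^sup>-\<^sup>1 M\<^sub>1 x\<close> (lemma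
  \<open>pole_orthogonal_hyperplane\<close>): poles depend on a form linearly through the matrix of its dual.
  Confocality of \<open>q\<^sub>3\<close> says that \<open>M\<^sub>3\<^sup>-\<^sup>1 = a M\<^sub>1\<^sup>-\<^sup>1 + b M\<^sub>2\<^sup>-\<^sup>1\<close> (lemma
  \<open>confocal_pencil_matrix\<close>), whence \<open>M\<^sub>3\<^sup>-\<^sup>1 M\<^sub>1 x = a x + b M\<^sub>2\<^sup>-\<^sup>1 M\<^sub>1 x\<close>. Thus \<open>p\<close> and the
  poles with respect to \<open>q\<^sub>2\<close> and \<open>q\<^sub>3\<close> are aligned. Since \<open>q\<^sub>3\<close> is not colinear to \<open>q\<^sub>1\<close>,
  \<open>b \<noteq> 0\<close>, so that \<open>p\<close> spans the same subspace with either of the two poles.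
  Hence one pole equals \<open>p\<close> exactly when the other does (lemma \<open>span_singleton_eq_iff\<close>), and
  otherwise the two lines agree; transversality is then a condition on the same line.
\<close>

section \<open>Quadratic forms and their symmetric matrices\<close>

lemma polar_commute: "polar q x y = polar q y x"
  by (simp add: polar_def add.commute)

lemma transpose_form_matrix: "transpose (form_matrix q) = form_matrix q"
  by (simp add: transpose_def form_matrix_def polar_commute)

lemma polar_self:
  assumes "quadratic_form q"
  shows "polar q x x = q x"
proof -
  obtain B where B: "bilinear B" "\<And>x. q x = B x x"
    using assms by (auto simp: quadratic_form_def)
  have "polar q x x = (B (x + x) (x + x) - B x x - B x x) / 2"
    by (simp only: polar_def B(2))
  also have "\<dots> = B x x"
    unfolding bilinear_ladd[OF B(1)] bilinear_radd[OF B(1)] by simp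
  finally show ?thesis by (simp add: B(2))
qed

lemma quadratic_form_eq_form_matrix:
  assumes "quadratic_form q"
  shows "q x = (form_matrix q *v x) \<bullet> x"
  using polar_self[OF assms, of x] polar_form_matrix[OF assms, of x x] by simp

lemma inner_symmetric_matrix:
  fixes A :: "real^'n^'n"
  assumes "transpose A = A"
  shows "(A *v x) \<bullet> y = x \<bullet> (A *v y)"
  using assms by (metis dot_lmul_matrix vector_transpose_matrix)

lemma quadratic_form_of_matrix: "quadratic_form (\<lambda>x. (A *v x) \<bullet> x)"
  unfolding quadratic_form_def
  by (rule exI[of _ "\<lambda>x y. (A *v x) \<bullet> y"])
    (auto simp: bilinear_def intro!: linearI
      simp: matrix_vector_right_distrib inner_left_distrib inner_right_distrib
        matrix_vector_mult_scaleR)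

lemma form_matrix_of_symmetric:
  fixes A :: "real^'n^'n"
  assumes "transpose A = A"
  shows "form_matrix (\<lambda>x. (A *v x) \<bullet> x) = A"
proof -
  have "polar (\<lambda>x. (A *v x) \<bullet> x) x y = (A *v x) \<bullet> y" for x y
    using inner_symmetric_matrix[OF assms, of x y]
    by (simp add: polar_def matrix_vector_right_distrib inner_left_distrib inner_right_distrib
        inner_commute)
  then show ?thesis
    using assms
    by (simp add: form_matrix_def vec_eq_iff inner_axis matrix_vector_mult_basis column_def
        transpose_def)
qed

lemma matrix_inv_cancel:
  assumes "invertible A"
  shows "A ** matrix_inv A = mat 1" and "matrix_inv A ** A = mat 1"
  using someI_ex[OF assms[unfolded invertible_def]] by (auto simp: matrix_inv_def)

lemma transpose_matrix_inv:
  fixes A :: "real^'n^'n"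
  assumes "invertible A" and "transpose A = A"
  shows "transpose (matrix_inv A) = matrix_inv A"
proof -
  have "transpose (matrix_inv A) ** A = mat 1"
    using arg_cong[OF matrix_inv_cancel(1)[OF assms(1)], of transpose] assms(2)
    by (simp add: matrix_transpose_mul transpose_mat)
  then show ?thesis
    by (metis assms(1) matrix_inv_cancel(1) matrix_mul_assoc matrix_mul_lid matrix_mul_rid)
qed

lemma matrix_inv_vector [simp]:
  fixes A :: "real^'n^'n"
  assumes "invertible A"
  shows "matrix_inv A *v (A *v x) = x" and "A *v (matrix_inv A *v x) = x"
  using assms
  by (simp_all add: matrix_vector_mul_assoc matrix_inv_cancel)

lemma form_matrix_dual_form:
  assumes "nondegenerate_form q"
  shows "form_matrix (dual_form q) = matrix_inv (form_matrix q)"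
  using assms form_matrix_of_symmetric[of "matrix_inv (form_matrix q)"]
    transpose_matrix_inv[OF _ transpose_form_matrix, of q]
  by (simp add: nondegenerate_form_def dual_form_def[abs_def])

lemma nondegenerate_dual_form:
  assumes "nondegenerate_form q"
  shows "nondegenerate_form (dual_form q)"
  using assms form_matrix_dual_form[OF assms] matrix_inv_cancel[of "form_matrix q"]
    quadratic_form_of_matrix[of "matrix_inv (form_matrix q)"]
  by (auto simp: nondegenerate_form_def invertible_def dual_form_def[abs_def])

section \<open>Confocal forms\<close>

text \<open>
  The relation \<open>M\<^sup>-\<^sup>1 = a M\<^sub>1\<^sup>-\<^sup>1 + b M\<^sub>2\<^sup>-\<^sup>1\<close> between matrices, applied to the vector \<open>M\<^sub>1 x\<close>
  because the pole of the tangent hyperplane at \<open>x\<close> is spanned by \<open>M\<^sup>-\<^sup>1 M\<^sub>1 x\<close>. If \<open>b\<close> were \<open>0\<close>,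
  \<open>M\<^sub>1\<close> would be a multiple of \<open>M\<close>, and the forms colinear.
\<close>
lemma confocal_pencil_matrix:
  assumes "nondegenerate_form q\<^sub>1" and "nondegenerate_form q\<^sub>2"
    and "q \<in> confocal_pencil q\<^sub>1 q\<^sub>2" and "\<not> colinear_forms q q\<^sub>1"
  obtains a b where "nondegenerate_form q" and "b \<noteq> 0"
    and "\<And>x. matrix_inv (form_matrix q) *v (form_matrix q\<^sub>1 *v x) =
      a *\<^sub>R x + b *\<^sub>R (matrix_inv (form_matrix q\<^sub>2) *v (form_matrix q\<^sub>1 *v x))"
proof -
  let ?M\<^sub>1 = "form_matrix q\<^sub>1" and ?M\<^sub>2 = "form_matrix q\<^sub>2"
  have inv: "invertible ?M\<^sub>1" "invertible ?M\<^sub>2"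
    using assms by (auto simp: nondegenerate_form_def)
  obtain h where h: "nondegenerate_form h" "h \<in> pencil (dual_form q\<^sub>1) (dual_form q\<^sub>2)"
    and q: "q = dual_form h"
    using assms(3) by (auto simp: confocal_pencil_def dual_set_def)
  obtain a b where hab: "h = (\<lambda>x. a * dual_form q\<^sub>1 x + b * dual_form q\<^sub>2 x)"
    using h(2) by (auto simp: pencil_def)
  let ?N = "a *\<^sub>R matrix_inv ?M\<^sub>1 + b *\<^sub>R matrix_inv ?M\<^sub>2"
  have N: "?N *v x = a *\<^sub>R (matrix_inv ?M\<^sub>1 *v x) + b *\<^sub>R (matrix_inv ?M\<^sub>2 *v x)" for x
    by (simp add: matrix_vector_mult_add_rdistrib scaleR_matrix_vector_assoc)
  have "transpose ?N = ?N"
    using transpose_matrix_inv[OF inv(1) transpose_form_matrix]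
      transpose_matrix_inv[OF inv(2) transpose_form_matrix]
    by (simp add: transpose_def vec_eq_iff)
  moreover have "h = (\<lambda>x. (?N *v x) \<bullet> x)"
    by (simp add: hab dual_form_def N inner_left_distrib)
  ultimately have hN: "form_matrix h = ?N"
    using form_matrix_of_symmetric by metis
  have invN: "invertible ?N"
    using h(1) by (simp add: nondegenerate_form_def hN)
  have nd: "nondegenerate_form q"
    using nondegenerate_dual_form[OF h(1)] by (simp add: q)
  have Mq: "form_matrix q = matrix_inv ?N"
    using form_matrix_dual_form[OF h(1)] by (simp add: q hN)
  have "matrix_inv (form_matrix q) *v y = ?N *v y" for y
  proof -
    have "y = form_matrix q *v (?N *v y)"
      using matrix_inv_vector[OF invN] by (simp add: Mq)
    then show ?thesis
      using matrix_inv_vector(1) nd by (metis nondegenerate_form_def)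
  qed
  then have eq: "matrix_inv (form_matrix q) *v (?M\<^sub>1 *v x) =
      a *\<^sub>R x + b *\<^sub>R (matrix_inv ?M\<^sub>2 *v (?M\<^sub>1 *v x))" for x
    by (simp add: N inv)
  have "b \<noteq> 0"
  proof
    assume "b = 0"
    have "?M\<^sub>1 *v x = a *\<^sub>R (form_matrix q *v x)" for x
    proof -
      have "?M\<^sub>1 *v x = form_matrix q *v (matrix_inv (form_matrix q) *v (?M\<^sub>1 *v x))"
        using nd by (simp add: nondegenerate_form_def)
      then show ?thesis
        by (simp add: eq \<open>b = 0\<close> matrix_vector_mult_scaleR)
    qed
    then have "q\<^sub>1 x = a * q x" for x
      using quadratic_form_eq_form_matrix[of q\<^sub>1 x] quadratic_form_eq_form_matrix[of q x]
        assms(1) nd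
      by (simp add: nondegenerate_form_def)
    then have "colinear_forms q q\<^sub>1"
      unfolding colinear_forms_def by (intro exI[of _ a] exI[of _ "-1"]) simp
    then show False using assms(4) by simp
  qed
  then show thesis using that nd eq by blast
qed

section \<open>Tangent hyperplanes and their poles\<close>

lemma proj_point_span:
  assumes "x \<noteq> 0"
  shows "proj_point (span {x})"
  using assms by (simp add: proj_point_def)

lemma proj_point_eq_span:
  assumes "proj_point p" and "x \<in> p" and "x \<noteq> 0"
  shows "p = span {x}"
proof -
  have "span {x} = span p"
    using assms by (intro dim_eq_span) (auto simp: proj_point_def)
  then show ?thesis
    using assms(1) by (simp add: proj_point_def flip: span_eq_iff)
qed

lemma proj_point_nonzero:
  assumes "proj_point p"
  obtains x where "x \<in> p" and "x \<noteq> 0"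
  using assms unfolding proj_point_def
  by (metis dim_eq_0 singleton_iff subsetI zero_neq_one)

lemma quadratic_form_scaleR:
  assumes "quadratic_form q"
  shows "q (c *\<^sub>R x) = c\<^sup>2 * q x"
  using assms
  by (simp add: quadratic_form_eq_form_matrix matrix_vector_mult_scaleR power2_eq_square)

lemma quadratic_form_add:
  "q (x + y) = q x + 2 * polar q x y + q y"
  by (simp add: polar_def field_simps)

text \<open>The origin is an exception for an empty quadric, whose union misses it although \<open>q 0 = 0\<close>.\<close>
lemma mem_Union_quadric:
  assumes "quadratic_form q" and "y \<noteq> 0"
  shows "y \<in> \<Union>(quadric q) \<longleftrightarrow> q y = 0"
proof
  assume "q y = 0"
  then have "\<forall>z\<in>span {y}. q z = 0"
    using quadratic_form_scaleR[OF assms(1)] by (auto simp: span_singleton)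
  then show "y \<in> \<Union>(quadric q)"
    using proj_point_span[OF assms(2)] by (auto simp: quadric_def intro: span_base)
qed (auto simp: quadric_def)

text \<open>
  Differentiating \<open>q (\<gamma> t) = 0\<close> shows that a velocity is \<open>q\<close>-orthogonal to \<open>x\<close>. Conversely, for
  \<open>v\<close> \<open>q\<close>-orthogonal to \<open>x\<close>, a curve \<open>\<gamma>\<close> on the cone has velocity \<open>v\<close>: non-degeneracy provides an
  isotropic \<open>w\<close> with \<open>polar q x w = 1\<close>, and the straight line \<open>x + t v\<close> is corrected by a multiple
  of \<open>w\<close>. Because \<open>w\<close> is isotropic, the equation for that multiple is linear, and its solution is
  of second order in \<open>t\<close>.
\<close>
lemma tangent_hyperplane_quadric:
  assumes nd: "nondegenerate_form q" and x: "x \<noteq> 0" "q x = 0"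
  shows "tangent_hyperplane (quadric q) (span {x}) = {v. (form_matrix q *v x) \<bullet> v = 0}"
proof (intro set_eqI iffI)
  have qf: "quadratic_form q"
    using nd by (simp add: nondegenerate_form_def)
  note B = bilinear_polar[OF qf]
  fix v
  {
    assume "v \<in> tangent_hyperplane (quadric q) (span {x})"
    then obtain \<gamma> where \<gamma>: "\<gamma> 0 \<in> span {x} - {0}" "\<forall>\<^sub>F t in nhds 0. \<gamma> t \<in> \<Union>(quadric q)"
      and der: "(\<gamma> has_vector_derivative v) (at 0)"
      by (auto simp: tangent_hyperplane_def)
    let ?A = "form_matrix q"
    have "((\<lambda>t. ?A *v \<gamma> t) has_vector_derivative ?A *v v) (at 0)"
      using bounded_linear.has_vector_derivative[OF matrix_vector_mul_bounded_linear der] .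
    then have "((\<lambda>t. (?A *v \<gamma> t) \<bullet> \<gamma> t) has_vector_derivative
        (?A *v \<gamma> 0) \<bullet> v + (?A *v v) \<bullet> \<gamma> 0) (at 0)"
      using bounded_bilinear.has_vector_derivative[OF bounded_bilinear_inner _ der] by blast
    moreover have "(?A *v \<gamma> 0) \<bullet> v + (?A *v v) \<bullet> \<gamma> 0 = 2 * ((?A *v \<gamma> 0) \<bullet> v)"
      using inner_symmetric_matrix[OF transpose_form_matrix, of q v "\<gamma> 0"]
      by (simp add: inner_commute)
    ultimately have "((\<lambda>t. q (\<gamma> t)) has_vector_derivative 2 * ((?A *v \<gamma> 0) \<bullet> v)) (at 0)"
      using quadratic_form_eq_form_matrix[OF qf] by simp
    moreover have zero: "\<forall>\<^sub>F t in nhds 0. q (\<gamma> t) = 0"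
      using \<gamma>(2) by eventually_elim (auto simp: quadric_def)
    have "((\<lambda>t. q (\<gamma> t)) has_vector_derivative 0) (at 0)"
      using zero eventually_nhds_x_imp_x[OF zero]
      by (subst has_vector_derivative_cong_ev[where g = "\<lambda>_. 0"])
        (auto elim: eventually_mono)
    ultimately have "(?A *v \<gamma> 0) \<bullet> v = 0"
      using vector_derivative_unique_at by fastforce
    moreover obtain c where "\<gamma> 0 = c *\<^sub>R x" "c \<noteq> 0"
      using \<gamma>(1) by (auto simp: span_singleton)
    ultimately show "v \<in> {v. (?A *v x) \<bullet> v = 0}"
      by (simp add: matrix_vector_mult_scaleR)
  next
    assume "v \<in> {v. (form_matrix q *v x) \<bullet> v = 0}"
    then have xv: "polar q x v = 0"
      using polar_form_matrix[OF qf] by simp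
    let ?n = "form_matrix q *v x"
    have "?n \<noteq> 0"
      using nd x(1) by (metis matrix_inv_vector(1) matrix_vector_mult_0_right nondegenerate_form_def)
    define w\<^sub>0 where "w\<^sub>0 = (1 / (?n \<bullet> ?n)) *\<^sub>R ?n"
    have xw\<^sub>0: "polar q x w\<^sub>0 = 1"
      using \<open>?n \<noteq> 0\<close> by (simp add: polar_form_matrix[OF qf] w\<^sub>0_def)
    \<comment> \<open>As \<open>x\<close> is isotropic, moving \<open>w\<^sub>0\<close> along it cancels \<open>q w\<^sub>0\<close> and keeps \<open>polar q x w\<^sub>0 = 1\<close>.\<close>
    define w where "w = w\<^sub>0 - (q w\<^sub>0 / 2) *\<^sub>R x"
    have xw: "polar q x w = 1"
      using xw\<^sub>0 x(2)
      by (simp add: w_def bilinear_rsub[OF B] bilinear_rmul[OF B] polar_self[OF qf])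
    have ww: "q w = 0"
      using quadratic_form_add[of q w\<^sub>0 "(- (q w\<^sub>0 / 2)) *\<^sub>R x"] xw\<^sub>0 x(2)
        quadratic_form_scaleR[OF qf, of "- (q w\<^sub>0 / 2)" x]
      by (simp add: w_def bilinear_rmul[OF B] polar_commute[of q w\<^sub>0] bilinear_rneg[OF B])
    define s where "s t = - (t\<^sup>2 * q v / 2) / (1 + t * polar q v w)" for t
    define \<gamma> where "\<gamma> t = x + t *\<^sub>R v + s t *\<^sub>R w" for t
    have "(s has_real_derivative 0) (at 0)"
      unfolding s_def[abs_def] by (auto intro!: derivative_eq_intros)
    then have der: "(\<gamma> has_vector_derivative v) (at 0)"
      unfolding \<gamma>_def[abs_def]
      by (auto intro!: derivative_eq_intros simp: has_real_derivative_iff_has_vector_derivative)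
    have \<gamma>0: "\<gamma> 0 = x"
      by (simp add: \<gamma>_def s_def)
    have "isCont \<gamma> 0"
      using der by (rule has_vector_derivative_continuous)
    then have "(\<gamma> \<longlongrightarrow> x) (nhds 0)"
      by (simp add: isCont_def \<gamma>0 tendsto_nhds_iff)
    then have ev1: "\<forall>\<^sub>F t in nhds 0. \<gamma> t \<noteq> 0"
      using x(1) by (rule tendsto_imp_eventually_ne)
    have "((\<lambda>t. 1 + t * polar q v w) \<longlongrightarrow> 1 + 0 * polar q v w) (nhds 0)"
      by (intro tendsto_intros) (simp add: filterlim_ident)
    then have ev2: "\<forall>\<^sub>F t in nhds 0. 1 + t * polar q v w \<noteq> 0"
      by (rule tendsto_imp_eventually_ne) simp
    have "\<forall>\<^sub>F t in nhds 0. \<gamma> t \<in> \<Union>(quadric q)"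
      using ev1 ev2
    proof eventually_elim
      case (elim t)
      have "q (\<gamma> t) = t\<^sup>2 * q v + 2 * s t * (1 + t * polar q v w)"
        using x(2) xv xw ww
        by (simp add: \<gamma>_def quadratic_form_add[of q x] quadratic_form_add[of q "t *\<^sub>R v"]
            bilinear_radd[OF B] quadratic_form_scaleR[OF qf] bilinear_ladd[OF B]
            bilinear_lmul[OF B] bilinear_rmul[OF B] algebra_simps)
      moreover have "s t * (1 + t * polar q v w) = - (t\<^sup>2 * q v / 2)"
        using elim(2) nonzero_eq_divide_eq s_def by metis
      ultimately have "q (\<gamma> t) = 0" by (simp add: mult.assoc)
      then show ?case
        using mem_Union_quadric[OF qf elim(1)] by simp
    qed
    then show "v \<in> tangent_hyperplane (quadric q) (span {x})"
      using der \<gamma>0 x(1) unfolding tangent_hyperplane_def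
      by (auto intro!: exI[of _ \<gamma>] simp: span_base)
  }
qed

lemma orthogonal_to_hyperplane_iff:
  fixes c z :: "'a::real_inner"
  shows "(\<forall>w. c \<bullet> w = 0 \<longrightarrow> z \<bullet> w = 0) \<longleftrightarrow> z \<in> span {c}"
proof
  assume L: "\<forall>w. c \<bullet> w = 0 \<longrightarrow> z \<bullet> w = 0"
  show "z \<in> span {c}"
  proof -
    \<comment> \<open>The component of \<open>z\<close> orthogonal to \<open>c\<close>; for \<open>c = 0\<close> the quotient is \<open>0\<close> and \<open>w = z\<close>.\<close>
    define w where "w = z - (c \<bullet> z / (c \<bullet> c)) *\<^sub>R c"
    have cw: "c \<bullet> w = 0"
      by (simp add: w_def inner_diff_right)
    then have "w \<bullet> w = 0"
      using L by (simp add: w_def inner_diff_left)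
    then have "z = (c \<bullet> z / (c \<bullet> c)) *\<^sub>R c"
      by (simp add: w_def)
    then show ?thesis
      by (metis rangeI span_singleton)
  qed
qed (auto simp: span_singleton)

lemma pole_orthogonal_hyperplane:
  assumes "nondegenerate_form q"
  shows "pole q {w. c \<bullet> w = 0} = span {matrix_inv (form_matrix q) *v c}"
proof -
  have qf: "quadratic_form q" and inv: "invertible (form_matrix q)"
    using assms by (auto simp: nondegenerate_form_def)
  have "y \<in> pole q {w. c \<bullet> w = 0} \<longleftrightarrow> form_matrix q *v y \<in> span {c}" for y
    by (simp add: pole_def polar_form_matrix[OF qf] flip: orthogonal_to_hyperplane_iff)
  also have "form_matrix q *v y \<in> span {c} \<longleftrightarrow> y \<in> span {matrix_inv (form_matrix q) *v c}" for y
  proof -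
    have "form_matrix q *v y = k *\<^sub>R c \<longleftrightarrow> y = k *\<^sub>R (matrix_inv (form_matrix q) *v c)" for k
      using matrix_inv_vector[OF inv] by (metis matrix_vector_mult_scaleR)
    then show ?thesis
      by (auto simp: span_singleton)
  qed
  finally show ?thesis by blast
qed

section \<open>The induced line-framed hypersurfaces\<close>

lemma span_insert_combination:
  fixes x y :: "'a::real_vector"
  assumes "b \<noteq> 0"
  shows "span {x, a *\<^sub>R x + b *\<^sub>R y} = span {x, y}"
proof -
  have "a *\<^sub>R x + b *\<^sub>R y \<in> span {x, y}"
    by (intro span_add span_scale span_base) auto
  moreover have "y \<in> span {x, a *\<^sub>R x + b *\<^sub>R y}"
  proof -
    have "y = (1 / b) *\<^sub>R ((a *\<^sub>R x + b *\<^sub>R y) - a *\<^sub>R x)"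
      using assms by simp
    moreover have "\<dots> \<in> span {x, a *\<^sub>R x + b *\<^sub>R y}"
      by (intro span_scale span_diff span_base) auto
    ultimately show ?thesis by simp
  qed
  ultimately show ?thesis
    by (intro subset_antisym span_minimal) (auto intro: span_base)
qed

lemma proj_line_span: "proj_line (span {x}) (span {y}) = span {x, y}"
  unfolding proj_line_def span_Un insert_is_Un[of x "{y}"] span_span ..

text \<open>
  Whether the pole is \<open>p\<close> itself can be read off from the subspace spanned by the pole and
  \<open>p\<close>, which is what confocal forms have in common.
\<close>
lemma span_singleton_eq_iff:
  fixes x y :: "'a::real_vector"
  assumes "y \<noteq> 0"
  shows "span {y} = span {x} \<longleftrightarrow> span {x, y} = span {x}"
proof
  assume "span {x, y} = span {x}"
  then have "y \<in> span {x}"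
    by (metis insertI1 insert_commute span_base)
  then obtain c where "y = c *\<^sub>R x"
    by (auto simp: span_singleton)
  with assms show "span {y} = span {x}"
    using span_image_scale[of "{x}" "\<lambda>_. c"] by simp
next
  assume "span {y} = span {x}"
  then have "y \<in> span {x}"
    using span_base[of y "{y}"] by simp
  then show "span {x, y} = span {x}"
    using span_redundant[of y "{x}"] by (simp add: insert_commute)
qed

theorem proposition2p38:
  fixes d :: nat and q\<^sub>1 q\<^sub>2 q\<^sub>3 :: "real^'n \<Rightarrow> real"
  assumes "CARD('n) = d + 1" and "d \<ge> 2"
    and "nondegenerate_form q\<^sub>1" and "nondegenerate_form q\<^sub>2"
    and "quadric q\<^sub>1 \<noteq> {}" and "quadric q\<^sub>2 \<noteq> {}" and "quadric q\<^sub>1 \<noteq> quadric q\<^sub>2"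
    and "q\<^sub>3 \<in> confocal_pencil q\<^sub>1 q\<^sub>2" and "\<not> colinear_forms q\<^sub>3 q\<^sub>1"
  shows "line_framed_hypersurface (quadric q\<^sub>1) q\<^sub>3 = line_framed_hypersurface (quadric q\<^sub>1) q\<^sub>2"
proof -
  obtain a b where nd: "nondegenerate_form q\<^sub>3" and "b \<noteq> 0"
    and comb: "\<And>x. matrix_inv (form_matrix q\<^sub>3) *v (form_matrix q\<^sub>1 *v x) =
      a *\<^sub>R x + b *\<^sub>R (matrix_inv (form_matrix q\<^sub>2) *v (form_matrix q\<^sub>1 *v x))"
    using confocal_pencil_matrix[OF assms(3,4,8,9)] by metis
  have same: "(pole q\<^sub>3 T = p \<longleftrightarrow> pole q\<^sub>2 T = p) \<and>
      proj_line p (pole q\<^sub>3 T) = proj_line p (pole q\<^sub>2 T)"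
    if p: "p \<in> quadric q\<^sub>1" and T: "T = tangent_hyperplane (quadric q\<^sub>1) p" for p T
  proof -
    obtain x where x: "x \<in> p" "x \<noteq> 0" and "proj_point p"
      using p proj_point_nonzero by (auto simp: quadric_def)
    then have px: "p = span {x}"
      using proj_point_eq_span by blast
    define y where "y q = matrix_inv (form_matrix q) *v (form_matrix q\<^sub>1 *v x)" for q
    have y_nonzero: "y q \<noteq> 0" if "nondegenerate_form q" for q
    proof
      assume "y q = 0"
      then have "form_matrix q\<^sub>1 *v x = 0"
        using that matrix_inv_vector(2)[of "form_matrix q" "form_matrix q\<^sub>1 *v x"]
        by (simp add: y_def nondegenerate_form_def)
      then show False
        using x(2) assms(3) matrix_inv_vector(1)[of "form_matrix q\<^sub>1" x]
        by (simp add: nondegenerate_form_def)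
    qed
    have "q\<^sub>1 x = 0"
      using p x(1) by (simp add: quadric_def)
    then have pole: "pole q T = span {y q}" if "nondegenerate_form q" for q
      using tangent_hyperplane_quadric[OF assms(3) x(2)] pole_orthogonal_hyperplane[OF that]
      by (simp add: T px y_def)
    have "span {x, y q\<^sub>3} = span {x, y q\<^sub>2}"
      using span_insert_combination[OF \<open>b \<noteq> 0\<close>] by (simp add: y_def comb)
    then show ?thesis
      using span_singleton_eq_iff[OF y_nonzero[OF nd]]
        span_singleton_eq_iff[OF y_nonzero[OF assms(4)]]
      by (simp add: pole[OF nd] pole[OF assms(4)] px proj_line_span)
  qed
  then show ?thesis
    unfolding line_framed_hypersurface_def by (intro Collect_cong) metis
qed

end
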